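(* Let $m,n\ge2$ and let $K$ and $L$ be regular languages over a common finite alphabet $\Sigma$ with $\kappa(K)=m$ and $\kappa(L)=n$. If $\kappa(K \sqcup\!\sqcup L)=f(m,n)$, where $$f(m,n)=2^{mn-1} + 2^{(m-1)(n-1)}(2^{m-1}-1)(2^{n-1}-1),$$ then $|\Sigma|\ge mn$.
   Context: The state complexity $\kappa(L)$ of a regular language $L$ over $\Sigma$ is the number of states of the minimal complete deterministic finite automaton over $\Sigma$ recognizing $L$. The shuffle of words $u,v\in\Sigma^*$ is $u \sqcup\!\sqcup v=\{u_1v_1\cdots u_kv_k \mid u=u_1\cdots u_k,\ v=v_1\cdots v_k,\ u_1,\ldots,u_k,v_1,\ldots,v_k\in\Sigma^*\}$, and the shuffle of languages $K,L\subseteq\Sigma^*$ is $K \sqcup\!\sqcup L=\bigcup_{u\in K,\,v\in L} u \sqcup\!\sqcup v$. *)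

theory Defs
  imports Main
begin

record ('q, 'a) dfa =
  states :: "'q set"
  init :: 'q
  final :: "'q set"
  trans :: "'q \<Rightarrow> 'a \<Rightarrow> 'q"

definition complete_dfa :: "'a set \<Rightarrow> ('q, 'a) dfa \<Rightarrow> bool" where
  "complete_dfa \<Sigma> A \<longleftrightarrow>
     finite (states A) \<and> init A \<in> states A \<and> final A \<subseteq> states A \<and>
     (\<forall>q\<in>states A. \<forall>a\<in>\<Sigma>. trans A q a \<in> states A)"

definition dfa_lang :: "'a set \<Rightarrow> ('q, 'a) dfa \<Rightarrow> 'a list set" where
  "dfa_lang \<Sigma> A = {w \<in> lists \<Sigma>. foldl (trans A) (init A) w \<in> final A}"

text \<open>State names are natural numbers in the next two definitions. This is no restriction: see
  \<open>regular_if_dfa\<close> and \<open>state_complexity_le\<close> below for automata with states of arbitrary type.\<close>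

definition regular :: "'a set \<Rightarrow> 'a list set \<Rightarrow> bool" where
  "regular \<Sigma> L \<longleftrightarrow> (\<exists>A :: (nat, 'a) dfa. complete_dfa \<Sigma> A \<and> dfa_lang \<Sigma> A = L)"

text \<open>Meaningful only for regular \<open>L\<close> (otherwise \<open>LEAST\<close> ranges over the empty set).\<close>

definition state_complexity :: "'a set \<Rightarrow> 'a list set \<Rightarrow> nat" where
  "state_complexity \<Sigma> L =
     (LEAST k. \<exists>A :: (nat, 'a) dfa. complete_dfa \<Sigma> A \<and> dfa_lang \<Sigma> A = L \<and> card (states A) = k)"

text \<open>The shuffle of words is \<open>shuffles\<close> from the list library; \<open>shuffles_eq_blocks\<close> below
  gives its description by factorizations into blocks.\<close>

definition lang_shuffle :: "'a list set \<Rightarrow> 'a list set \<Rightarrow> 'a list set" where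
  "lang_shuffle K L = (\<Union>u\<in>K. \<Union>v\<in>L. shuffles u v)"

lemma append_in_shuffles:
  "x \<in> shuffles a b \<Longrightarrow> y \<in> shuffles c d \<Longrightarrow> x @ y \<in> shuffles (a @ c) (b @ d)"
proof (induction a b arbitrary: x rule: shuffles.induct)
  case (1 ys)
  then show ?case
    by (induction ys arbitrary: x) (auto intro: Cons_in_shuffles_rightI)
next
  case (2 xs)
  then show ?case
    by (induction xs arbitrary: x) (auto intro: Cons_in_shuffles_leftI)
next
  case (3 p xs q ys)
  then show ?case
    by (auto intro: Cons_in_shuffles_leftI Cons_in_shuffles_rightI)
qed

lemma shuffles_eq_blocks:
  "shuffles u v = {concat (map2 (@) us vs) | us vs.
     length us = length vs \<and> concat us = u \<and> concat vs = v}" (is "_ = ?B u v")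
proof
  have left: "x # w \<in> ?B (x # a) b" if w: "w \<in> ?B a b" for x w a b
  proof -
    from w obtain us vs where "w = concat (map2 (@) us vs)" "length us = length vs"
      "concat us = a" "concat vs = b" by blast
    then show ?thesis
      by (intro CollectI exI[of _ "[x] # us"] exI[of _ "[] # vs"]) simp
  qed
  have right: "x # w \<in> ?B a (x # b)" if w: "w \<in> ?B a b" for x w a b
  proof -
    from w obtain us vs where "w = concat (map2 (@) us vs)" "length us = length vs"
      "concat us = a" "concat vs = b" by blast
    then show ?thesis
      by (intro CollectI exI[of _ "[] # us"] exI[of _ "[x] # vs"]) simp
  qed
  have "w \<in> ?B u v" if "w \<in> shuffles u v" for w
    using that
  proof (induction u v arbitrary: w rule: shuffles.induct)
    case (1 ys)
    then show ?case by (intro CollectI exI[of _ "[[]]"] exI[of _ "[ys]"]) simp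
  next
    case (2 xs)
    then show ?case by (intro CollectI exI[of _ "[xs]"] exI[of _ "[[]]"]) simp
  next
    case (3 x xs y ys)
    from "3.prems" consider w' where "w = x # w'" "w' \<in> shuffles xs (y # ys)"
      | w' where "w = y # w'" "w' \<in> shuffles (x # xs) ys" by auto
    then show ?case
    proof cases
      case 1
      show ?thesis unfolding 1(1) by (rule left, rule "3.IH"(1), rule 1(2))
    next
      case 2
      show ?thesis unfolding 2(1) by (rule right, rule "3.IH"(2), rule 2(2))
    qed
  qed
  then show "shuffles u v \<subseteq> ?B u v" by blast
next
  have "concat (map2 (@) us vs) \<in> shuffles (concat us) (concat vs)"
    if "length us = length vs" for us vs :: "'a list list"
    using that
  proof (induction us vs rule: list_induct2)
    case (Cons x xs y ys)
    have "x @ y \<in> shuffles (x @ []) ([] @ y)"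
      by (rule append_in_shuffles) auto
    then have "x @ y \<in> shuffles x y" by simp
    from append_in_shuffles[OF this Cons.IH] show ?case by simp
  qed simp
  then show "?B u v \<subseteq> shuffles u v" by blast
qed

lemma dfa_nat_states:
  fixes A :: "('q, 'a) dfa"
  assumes A: "complete_dfa \<Sigma> A"
  shows "\<exists>B :: (nat, 'a) dfa. complete_dfa \<Sigma> B \<and> dfa_lang \<Sigma> B = dfa_lang \<Sigma> A \<and>
           card (states B) = card (states A)"
proof -
  from A have "finite (states A)" by (simp add: complete_dfa_def)
  then obtain f :: "'q \<Rightarrow> nat" where inj: "inj_on f (states A)"
    using finite_imp_inj_to_nat_seg by blast
  define g where "g = inv_into (states A) f"
  have gf: "g (f q) = q" if "q \<in> states A" for q
    using that inj by (simp add: g_def)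
  define B where "B = \<lparr>states = f ` states A, init = f (init A), final = f ` final A,
    trans = (\<lambda>q a. f (trans A (g q) a))\<rparr>"
  have run: "foldl (trans B) (f q) w = f (foldl (trans A) q w) \<and> foldl (trans A) q w \<in> states A"
    if "q \<in> states A" "w \<in> lists \<Sigma>" for q w
    using that(2,1) A by (induction w arbitrary: q) (auto simp: B_def gf complete_dfa_def)
  have "complete_dfa \<Sigma> B"
    using A by (auto simp: complete_dfa_def B_def gf)
  moreover have "dfa_lang \<Sigma> B = dfa_lang \<Sigma> A"
  proof -
    have "foldl (trans B) (init B) w \<in> final B \<longleftrightarrow> foldl (trans A) (init A) w \<in> final A"
      if w: "w \<in> lists \<Sigma>" for w
    proof -
      have i: "init A \<in> states A" and fin: "final A \<subseteq> states A"
        using A by (auto simp: complete_dfa_def)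
      have "init B = f (init A)" "final B = f ` final A" by (simp_all add: B_def)
      then show ?thesis
        using run[OF i w] inj_on_image_mem_iff[OF inj _ fin] by simp
    qed
    then show ?thesis by (auto simp: dfa_lang_def)
  qed
  moreover have "card (states B) = card (states A)"
    using inj by (simp add: B_def card_image)
  ultimately show ?thesis by blast
qed

lemma regular_if_dfa:
  "complete_dfa \<Sigma> A \<Longrightarrow> regular \<Sigma> (dfa_lang \<Sigma> A)"
  using dfa_nat_states unfolding regular_def by blast

lemma state_complexity_le:
  "complete_dfa \<Sigma> A \<Longrightarrow> state_complexity \<Sigma> (dfa_lang \<Sigma> A) \<le> card (states A)"
  unfolding state_complexity_def by (rule Least_le) (rule dfa_nat_states)

lemma state_complexity_attained:
  assumes "regular \<Sigma> L"
  obtains A :: "(nat, 'a) dfa"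
  where "complete_dfa \<Sigma> A" "dfa_lang \<Sigma> A = L" "card (states A) = state_complexity \<Sigma> L"
proof -
  from assms have "\<exists>k. \<exists>A :: (nat, 'a) dfa. complete_dfa \<Sigma> A \<and> dfa_lang \<Sigma> A = L \<and> card (states A) = k"
    unfolding regular_def by blast
  from LeastI_ex[OF this] that show thesis unfolding state_complexity_def by blast
qed

end

theory Submission
  imports Defs
begin

text \<open>Let \<open>P\<close>, \<open>Q\<close> be the state sets of minimal automata for \<open>K\<close>, \<open>L\<close>, with initial states \<open>i\<close>, \<open>j\<close>.
  The subset construction for the shuffle only uses subsets of \<open>P \<times> Q\<close> meeting row \<open>i\<close> and column
  \<open>j\<close>, and there are \<open>f(m,n)\<close> of those. If the bound is attained, every such subset other than
  \<open>{(i, j)}\<close> is the image of a different one under some letter, and every singleton \<open>{x}\<close> is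
  the set of grid points from which some word leads to a final pair.

  Reaching \<open>{(i, j), (p, q)}\<close> takes a letter that sends \<open>(i, j)\<close> to \<open>(p, q)\<close> componentwise, and that
  transposes \<open>i\<close>, \<open>p\<close> and \<open>j\<close>, \<open>q\<close> if \<open>p \<noteq> i\<close> and \<open>q \<noteq> j\<close>. This gives \<open>mn - 1\<close> letters; suppose there are
  no others. If \<open>m, n \<ge> 3\<close>, then the set \<open>{(i, j)} \<union> (P - {i}) \<times> (Q - {j})\<close> has no predecessor. If
  \<open>P = {i, p}\<close>, consider the letter \<open>b\<close> for \<open>(p, j)\<close>. If \<open>b\<close> permutes \<open>P\<close>, then so do all letters,
  and then backward images of final pairs can be singletons only within one column. Otherwise,
  if \<open>n \<ge> 3\<close>, the sets with row \<open>i\<close> equal to \<open>Q - {j}\<close> and row \<open>p\<close> equal to \<open>{j} \<union> Z\<close>, \<open>|Z| \<le> 1\<close>, need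
  \<open>n\<close> distinct letters among the \<open>n - 1\<close> ones moving both \<open>i\<close> and \<open>j\<close>; if \<open>n = 2\<close>, exchanging the
  roles of \<open>P\<close> and \<open>Q\<close> leads back to the permutation case.\<close>

section \<open>Minimal automata: predecessors and distinguishing words\<close>

lemma foldl_trans_in_states:
  "complete_dfa \<Sigma> A \<Longrightarrow> w \<in> lists \<Sigma> \<Longrightarrow> q \<in> states A \<Longrightarrow> foldl (trans A) q w \<in> states A"
  by (induction w arbitrary: q) (auto simp: complete_dfa_def)

text \<open>Otherwise no transition enters \<open>s\<close> from another state, so \<open>s\<close>
  is unreachable and can be deleted without changing the language.\<close>

lemma minimal_dfa_predecessor:
  assumes A: "complete_dfa \<Sigma> A" and min: "state_complexity \<Sigma> (dfa_lang \<Sigma> A) \<ge> card (states A)"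
    and s: "s \<in> states A" "s \<noteq> init A"
  shows "\<exists>t\<in>states A. \<exists>a\<in>\<Sigma>. t \<noteq> s \<and> trans A t a = s"
proof (rule ccontr)
  assume no: "\<not> ?thesis"
  define B where "B = A\<lparr>states := states A - {s}, final := final A - {s}\<rparr>"
  have B: "complete_dfa \<Sigma> B"
    using A no s by (auto simp: complete_dfa_def B_def)
  have [simp]: "init B = init A" "trans B = trans A" "final B = final A - {s}"
    by (simp_all add: B_def)
  have "foldl (trans A) (init A) w \<noteq> s" if "w \<in> lists \<Sigma>" for w
    using foldl_trans_in_states[OF B that, of "init A"] B by (auto simp: complete_dfa_def B_def)
  then have "dfa_lang \<Sigma> B = dfa_lang \<Sigma> A"
    by (auto simp: dfa_lang_def)
  moreover have "card (states B) < card (states A)"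
  proof (rule psubset_card_mono)
    show "states B \<subset> states A" using s by (auto simp: B_def)
  qed (use A in \<open>simp add: complete_dfa_def\<close>)
  ultimately show False
    using state_complexity_le[OF B] min by simp
qed

text \<open>Otherwise every transition into \<open>t\<close> could be redirected to the equivalent
  state \<open>s\<close>, and \<open>t\<close> dropped.\<close>

lemma minimal_dfa_distinguishable:
  assumes A: "complete_dfa \<Sigma> A" and min: "state_complexity \<Sigma> (dfa_lang \<Sigma> A) \<ge> card (states A)"
    and s: "s \<in> states A" "t \<in> states A" "s \<noteq> t"
  shows "\<exists>w\<in>lists \<Sigma>. (foldl (trans A) s w \<in> final A) \<noteq> (foldl (trans A) t w \<in> final A)"
proof (rule ccontr)
  assume no: "\<not> ?thesis"
  define h where "h q = (if q = t then s else q)" for q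
  define B where "B = A\<lparr>states := states A - {t}, init := h (init A), final := final A - {t},
    trans := (\<lambda>q a. h (trans A q a))\<rparr>"
  have B: "complete_dfa \<Sigma> B"
    using A s by (auto simp: complete_dfa_def B_def h_def)
  have h: "foldl (trans A) (h q) w \<in> final A \<longleftrightarrow> foldl (trans A) q w \<in> final A"
    if "w \<in> lists \<Sigma>" for q w
    using no that by (auto simp: h_def)
  have run: "foldl (trans B) (h q) w \<in> final B \<longleftrightarrow> foldl (trans A) q w \<in> final A"
    if "w \<in> lists \<Sigma>" "q \<in> states A" for w q
    using that
  proof (induction w arbitrary: q)
    case Nil
    then show ?case using h[of "[]" q] s by (auto simp: B_def h_def)
  next
    case (Cons a w)
    from Cons.prems have "h q \<in> states A" using s by (auto simp: h_def)
    moreover have "trans B (h q) a = h (trans A (h q) a)" by (simp add: B_def)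
    moreover have "foldl (trans A) (trans A (h q) a) w \<in> final A \<longleftrightarrow>
        foldl (trans A) (trans A q a) w \<in> final A"
      using h[of "a # w" q] Cons.hyps by simp
    moreover have "trans A (h q) a \<in> states A"
      using \<open>h q \<in> states A\<close> Cons.hyps A by (auto simp: complete_dfa_def)
    ultimately show ?case
      using Cons.IH[of "trans A (h q) a"] by simp
  qed
  have "init B = h (init A)" "init A \<in> states A"
    using A by (auto simp: B_def complete_dfa_def)
  then have "dfa_lang \<Sigma> B = dfa_lang \<Sigma> A"
    unfolding dfa_lang_def by (intro Collect_cong conj_cong refl) (simp add: run)
  moreover have "card (states B) < card (states A)"
  proof (rule psubset_card_mono)
    show "states B \<subset> states A" using s by (auto simp: B_def)
  qed (use A in \<open>simp add: complete_dfa_def\<close>)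
  ultimately show False
    using state_complexity_le[OF B] min by simp
qed

section \<open>The subset automaton for the shuffle and the number of its states\<close>

definition shuffle_step ::
    "('p \<Rightarrow> 'a \<Rightarrow> 'p) \<Rightarrow> ('q \<Rightarrow> 'a \<Rightarrow> 'q) \<Rightarrow> 'a \<Rightarrow> ('p \<times> 'q) set \<Rightarrow> ('p \<times> 'q) set" where
  "shuffle_step f g a S =
     {(x, y). (\<exists>t. (t, y) \<in> S \<and> f t a = x) \<or> (\<exists>t. (x, t) \<in> S \<and> g t a = y)}"

definition shuffle_pre ::
    "('p \<Rightarrow> 'a \<Rightarrow> 'p) \<Rightarrow> ('q \<Rightarrow> 'a \<Rightarrow> 'q) \<Rightarrow> 'a \<Rightarrow> ('p \<times> 'q) set \<Rightarrow> ('p \<times> 'q) set" where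
  "shuffle_pre f g a R = {(x, y). (f x a, y) \<in> R \<or> (x, g y a) \<in> R}"

text \<open>The invariant of the sets reachable from \<open>{(i, j)}\<close>: a point of row
  \<open>i\<close> stays in that row when the second component reads the letter, and likewise for
  column \<open>j\<close>.\<close>

definition crossing :: "'p set \<Rightarrow> 'q set \<Rightarrow> 'p \<Rightarrow> 'q \<Rightarrow> ('p \<times> 'q) set \<Rightarrow> bool" where
  "crossing P Q i j S \<longleftrightarrow> S \<subseteq> P \<times> Q \<and> (\<exists>y. (i, y) \<in> S) \<and> (\<exists>x. (x, j) \<in> S)"

text \<open>\<open>shuffle_step\<close> and \<open>shuffle_pre\<close> are image and preimage under
  the same one-letter relation on pairs, so a word can be run backwards from \<open>E\<close>
  instead of forwards from \<open>S\<close>.\<close>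

lemma foldl_shuffle_step_meets:
  "foldl (\<lambda>S a. shuffle_step f g a S) S w \<inter> E \<noteq> {} \<longleftrightarrow> S \<inter> foldr (shuffle_pre f g) w E \<noteq> {}"
proof (induction w arbitrary: S)
  case (Cons a w)
  have "shuffle_step f g a S \<inter> R \<noteq> {} \<longleftrightarrow> S \<inter> shuffle_pre f g a R \<noteq> {}" for R
    by (fastforce simp: shuffle_step_def shuffle_pre_def)
  with Cons show ?case by simp
qed simp

lemma foldr_shuffle_pre_iff:
  "(p, q) \<in> foldr (shuffle_pre f g) w (F \<times> G) \<longleftrightarrow>
     (\<exists>u v. w \<in> shuffles u v \<and> foldl f p u \<in> F \<and> foldl g q v \<in> G)"
proof (induction w arbitrary: p q)
  case (Cons a w)
  have "(\<exists>u v. a # w \<in> shuffles u v \<and> foldl f p u \<in> F \<and> foldl g q v \<in> G) \<longleftrightarrow>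
      (\<exists>u v. w \<in> shuffles u v \<and> foldl f (f p a) u \<in> F \<and> foldl g q v \<in> G) \<or>
      (\<exists>u v. w \<in> shuffles u v \<and> foldl f p u \<in> F \<and> foldl g (g q a) v \<in> G)" (is "?L \<longleftrightarrow> ?R1 \<or> ?R2")
  proof
    assume ?L
    then obtain u v where uv: "a # w \<in> shuffles u v" "foldl f p u \<in> F" "foldl g q v \<in> G" by blast
    from uv(1) consider u' where "u = a # u'" "w \<in> shuffles u' v"
      | v' where "v = a # v'" "w \<in> shuffles u v'"
      by (auto simp: Cons_in_shuffles_iff neq_Nil_conv)
    then show "?R1 \<or> ?R2"
      using uv by cases auto
  next
    have "?R1 \<Longrightarrow> ?L"
      by (metis Cons_in_shuffles_leftI foldl_Cons)
    moreover have "?R2 \<Longrightarrow> ?L"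
      by (metis Cons_in_shuffles_rightI foldl_Cons)
    ultimately show "?R1 \<or> ?R2 \<Longrightarrow> ?L" by blast
  qed
  with Cons show ?case by (simp add: shuffle_pre_def)
qed simp

definition shuffle_dfa :: "('p, 'a) dfa \<Rightarrow> ('q, 'a) dfa \<Rightarrow> (('p \<times> 'q) set, 'a) dfa" where
  "shuffle_dfa A B =
     \<lparr>states = {S. crossing (states A) (states B) (init A) (init B) S},
      init = {(init A, init B)},
      final = {S. crossing (states A) (states B) (init A) (init B) S \<and> S \<inter> final A \<times> final B \<noteq> {}},
      trans = (\<lambda>S a. shuffle_step (trans A) (trans B) a S)\<rparr>"

lemma crossing_shuffle_step:
  assumes A: "complete_dfa \<Sigma> A" and B: "complete_dfa \<Sigma> B" and a: "a \<in> \<Sigma>"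
    and S: "crossing (states A) (states B) (init A) (init B) S"
  shows "crossing (states A) (states B) (init A) (init B) (shuffle_step (trans A) (trans B) a S)"
proof -
  from S obtain x y where xy: "(init A, y) \<in> S" "(x, init B) \<in> S"
    and sub: "S \<subseteq> states A \<times> states B" by (auto simp: crossing_def)
  have "(init A, trans B y a) \<in> shuffle_step (trans A) (trans B) a S"
    "(trans A x a, init B) \<in> shuffle_step (trans A) (trans B) a S"
    using xy by (auto simp: shuffle_step_def)
  moreover have "shuffle_step (trans A) (trans B) a S \<subseteq> states A \<times> states B"
  proof (rule subrelI)
    fix x y
    assume "(x, y) \<in> shuffle_step (trans A) (trans B) a S"
    then consider t where "(t, y) \<in> S" "x = trans A t a" | t where "(x, t) \<in> S" "y = trans B t a"
      by (auto simp: shuffle_step_def)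
    then show "(x, y) \<in> states A \<times> states B"
      using sub A B a by cases (auto simp: complete_dfa_def)
  qed
  ultimately show ?thesis by (auto simp: crossing_def)
qed

lemma complete_shuffle_dfa:
  assumes A: "complete_dfa \<Sigma> A" and B: "complete_dfa \<Sigma> B"
  shows "complete_dfa \<Sigma> (shuffle_dfa A B)"
proof -
  have "finite {S. crossing (states A) (states B) (init A) (init B) S}"
    by (rule finite_subset[of _ "Pow (states A \<times> states B)"])
      (use A B in \<open>auto simp: crossing_def complete_dfa_def\<close>)
  moreover have "crossing (states A) (states B) (init A) (init B) {(init A, init B)}"
    using A B by (auto simp: crossing_def complete_dfa_def)
  ultimately show ?thesis
    using crossing_shuffle_step[OF A B] by (auto simp: complete_dfa_def shuffle_dfa_def)
qed

lemma lists_shuffles_iff: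
  "w \<in> shuffles u v \<Longrightarrow> w \<in> lists \<Sigma> \<longleftrightarrow> u \<in> lists \<Sigma> \<and> v \<in> lists \<Sigma>"
  using set_shuffles by fastforce

lemma foldl_shuffle_dfa_final:
  assumes A: "complete_dfa \<Sigma> A" and B: "complete_dfa \<Sigma> B"
    and S: "S \<in> states (shuffle_dfa A B)" and w: "w \<in> lists \<Sigma>"
  shows "foldl (trans (shuffle_dfa A B)) S w \<in> final (shuffle_dfa A B) \<longleftrightarrow>
    S \<inter> foldr (shuffle_pre (trans A) (trans B)) w (final A \<times> final B) \<noteq> {}"
  using foldl_trans_in_states[OF complete_shuffle_dfa[OF A B] w S]
  by (simp add: shuffle_dfa_def foldl_shuffle_step_meets)

lemma dfa_lang_shuffle_dfa:
  assumes A: "complete_dfa \<Sigma> A" and B: "complete_dfa \<Sigma> B"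
  shows "dfa_lang \<Sigma> (shuffle_dfa A B) = lang_shuffle (dfa_lang \<Sigma> A) (dfa_lang \<Sigma> B)"
proof -
  have i: "init (shuffle_dfa A B) \<in> states (shuffle_dfa A B)"
    using complete_shuffle_dfa[OF A B] by (simp add: complete_dfa_def)
  have "init (shuffle_dfa A B) = {(init A, init B)}" by (simp add: shuffle_dfa_def)
  then have "w \<in> dfa_lang \<Sigma> (shuffle_dfa A B) \<longleftrightarrow> w \<in> lists \<Sigma> \<and>
      (\<exists>u v. w \<in> shuffles u v \<and> foldl (trans A) (init A) u \<in> final A \<and>
        foldl (trans B) (init B) v \<in> final B)" for w
    using foldl_shuffle_dfa_final[OF A B i, of w] by (auto simp: dfa_lang_def foldr_shuffle_pre_iff)
  moreover have "w \<in> lang_shuffle (dfa_lang \<Sigma> A) (dfa_lang \<Sigma> B) \<longleftrightarrow> w \<in> lists \<Sigma> \<and>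
      (\<exists>u v. w \<in> shuffles u v \<and> foldl (trans A) (init A) u \<in> final A \<and>
        foldl (trans B) (init B) v \<in> final B)" for w
  proof -
    have "w \<in> lang_shuffle (dfa_lang \<Sigma> A) (dfa_lang \<Sigma> B) \<longleftrightarrow>
        (\<exists>u v. w \<in> shuffles u v \<and> (u \<in> lists \<Sigma> \<and> v \<in> lists \<Sigma>) \<and>
          foldl (trans A) (init A) u \<in> final A \<and> foldl (trans B) (init B) v \<in> final B)"
      unfolding lang_shuffle_def dfa_lang_def by fast
    also have "\<dots> \<longleftrightarrow> (\<exists>u v. w \<in> shuffles u v \<and> w \<in> lists \<Sigma> \<and>
          foldl (trans A) (init A) u \<in> final A \<and> foldl (trans B) (init B) v \<in> final B)"
      by (intro ex_cong1 conj_cong refl) (simp add: lists_shuffles_iff)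
    finally show ?thesis by blast
  qed
  ultimately show ?thesis by blast
qed

text \<open>Sets containing \<open>(i, j)\<close> are arbitrary elsewhere, which gives the first
  summand. The others are determined by nonempty traces on the rest of column \<open>j\<close> and
  of row \<open>i\<close>, and an arbitrary trace off both.\<close>

lemma card_crossing_le:
  assumes P: "finite P" "i \<in> P" and Q: "finite Q" "j \<in> Q"
  shows "card {S. crossing P Q i j S} \<le> 2 ^ (card P * card Q - 1) +
    2 ^ ((card P - 1) * (card Q - 1)) * (2 ^ (card P - 1) - 1) * (2 ^ (card Q - 1) - 1)"
proof -
  define X where "X = (P - {i}) \<times> {j}"
  define Y where "Y = {i} \<times> (Q - {j})"
  define Z where "Z = (P - {i}) \<times> (Q - {j})"
  define C where "C = Pow (P \<times> Q - {(i, j)})"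
  define D where "D = Pow Z \<times> (Pow X - {{}}) \<times> (Pow Y - {{}})"
  have cX: "card X = card P - 1" and cY: "card Y = card Q - 1"
    and cZ: "card Z = (card P - 1) * (card Q - 1)"
    using P Q by (simp_all add: X_def Y_def Z_def card_cartesian_product)
  have fin: "finite X" "finite Y" "finite Z" using P Q by (simp_all add: X_def Y_def Z_def)
  have "card {S. crossing P Q i j S \<and> (i, j) \<in> S} \<le> card C"
  proof (rule card_inj_on_le)
    show "inj_on (\<lambda>S. S - {(i, j)}) {S. crossing P Q i j S \<and> (i, j) \<in> S}"
      by (auto simp: inj_on_def)
  qed (use P Q in \<open>auto simp: C_def crossing_def\<close>)
  also have "card C = 2 ^ (card P * card Q - 1)"
    using P Q by (simp add: C_def card_Pow card_cartesian_product)
  finally have 1: "card {S. crossing P Q i j S \<and> (i, j) \<in> S} \<le> 2 ^ (card P * card Q - 1)" .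
  have "card {S. crossing P Q i j S \<and> (i, j) \<notin> S} \<le> card D"
  proof (rule card_inj_on_le)
    show "inj_on (\<lambda>S. (S \<inter> Z, S \<inter> X, S \<inter> Y)) {S. crossing P Q i j S \<and> (i, j) \<notin> S}"
    proof (rule inj_onI)
      fix S T
      assume S: "S \<in> {S. crossing P Q i j S \<and> (i, j) \<notin> S}"
        and T: "T \<in> {S. crossing P Q i j S \<and> (i, j) \<notin> S}"
        and eq: "(S \<inter> Z, S \<inter> X, S \<inter> Y) = (T \<inter> Z, T \<inter> X, T \<inter> Y)"
      have "S \<subseteq> Z \<union> X \<union> Y" "T \<subseteq> Z \<union> X \<union> Y"
        using S T by (auto simp: crossing_def X_def Y_def Z_def)
      then show "S = T" using eq by blast
    qed
    show "(\<lambda>S. (S \<inter> Z, S \<inter> X, S \<inter> Y)) ` {S. crossing P Q i j S \<and> (i, j) \<notin> S} \<subseteq> D"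
      by (fastforce simp: D_def crossing_def X_def Y_def)
  qed (use fin in \<open>simp add: D_def\<close>)
  also have "card D = 2 ^ ((card P - 1) * (card Q - 1)) * (2 ^ (card P - 1) - 1) * (2 ^ (card Q - 1) - 1)"
    using fin by (simp add: D_def card_cartesian_product card_Pow cX cY cZ)
  finally have 2: "card {S. crossing P Q i j S \<and> (i, j) \<notin> S} \<le> \<dots>" .
  have "card {S. crossing P Q i j S} =
      card ({S. crossing P Q i j S \<and> (i, j) \<in> S} \<union> {S. crossing P Q i j S \<and> (i, j) \<notin> S})"
    by (rule arg_cong[of _ _ card]) blast
  also have "\<dots> \<le> card {S. crossing P Q i j S \<and> (i, j) \<in> S} + card {S. crossing P Q i j S \<and> (i, j) \<notin> S}"
    by (rule card_Un_le)
  finally show ?thesis using 1 2 by linarith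
qed

section \<open>The grid of state pairs when the bound is attained\<close>

locale shuffle_grid =
  fixes \<Sigma> :: "'a set" and P :: "'p set" and Q :: "'q set" and i j f g F G
  assumes fin\<Sigma>: "finite \<Sigma>" and finP: "finite P" and finQ: "finite Q"
    and i: "i \<in> P" and j: "j \<in> Q"
    and f: "\<And>p a. p \<in> P \<Longrightarrow> a \<in> \<Sigma> \<Longrightarrow> f p a \<in> P"
    and g: "\<And>q a. q \<in> Q \<Longrightarrow> a \<in> \<Sigma> \<Longrightarrow> g q a \<in> Q"
    and F: "F \<subseteq> P" and G: "G \<subseteq> Q"
    and predecessor: "\<And>S. crossing P Q i j S \<Longrightarrow> S \<noteq> {(i, j)} \<Longrightarrow>
      \<exists>T. \<exists>a\<in>\<Sigma>. crossing P Q i j T \<and> T \<noteq> S \<and> shuffle_step f g a T = S"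
    and separating: "\<And>x. x \<in> P \<times> Q \<Longrightarrow>
      \<exists>w\<in>lists \<Sigma>. (P \<times> Q) \<inter> foldr (shuffle_pre f g) w (F \<times> G) = {x}"
begin

text \<open>The form in which all later case analyses use predecessors; there the last three facts
  are called \<open>L\<close>, \<open>R\<close> and \<open>C\<close>.\<close>

lemma predecessor_elim:
  assumes "S \<subseteq> P \<times> Q" "(i, y) \<in> S" "(x, j) \<in> S" "S \<noteq> {(i, j)}"
  obtains T a r s where "a \<in> \<Sigma>" "T \<subseteq> P \<times> Q" "T \<noteq> S" "(i, s) \<in> T" "(r, j) \<in> T"
    "\<And>x y. (x, y) \<in> T \<Longrightarrow> (f x a, y) \<in> S" "\<And>x y. (x, y) \<in> T \<Longrightarrow> (x, g y a) \<in> S"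
    "\<And>x y. (x, y) \<in> S \<Longrightarrow> (\<exists>t. (t, y) \<in> T \<and> f t a = x) \<or> (\<exists>t. (x, t) \<in> T \<and> g t a = y)"
proof -
  have "crossing P Q i j S" using assms by (auto simp: crossing_def)
  from predecessor[OF this assms(4)] obtain T a where
    a: "a \<in> \<Sigma>" and T: "crossing P Q i j T" "T \<noteq> S" and S: "shuffle_step f g a T = S" by blast
  from T(1) obtain s r where sr: "T \<subseteq> P \<times> Q" "(i, s) \<in> T" "(r, j) \<in> T"
    by (auto simp: crossing_def)
  have S_iff: "(x, y) \<in> S \<longleftrightarrow> (\<exists>t. (t, y) \<in> T \<and> f t a = x) \<or> (\<exists>t. (x, t) \<in> T \<and> g t a = y)" for x y
    using S by (auto simp: shuffle_step_def)
  show thesis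
    by (rule that[OF a sr(1) T(2) sr(2,3)]) (auto simp: S_iff)
qed

lemma mirror: "shuffle_grid \<Sigma> Q P j i g f G F"
proof
  have swap_step: "shuffle_step g f a (prod.swap ` T) = prod.swap ` shuffle_step f g a T" for a T
    by (force simp: shuffle_step_def)
  show "\<exists>T. \<exists>a\<in>\<Sigma>. crossing Q P j i T \<and> T \<noteq> S \<and> shuffle_step g f a T = S"
    if S: "crossing Q P j i S" "S \<noteq> {(j, i)}" for S
  proof -
    have swap_swap: "prod.swap ` prod.swap ` S = S" for S :: "('q \<times> 'p) set"
      by (simp add: image_image)
    have "crossing P Q i j (prod.swap ` S)"
      using S(1) unfolding crossing_def by force
    moreover have "prod.swap ` S \<noteq> {(i, j)}"
      using S(2) swap_swap[of S] by auto
    ultimately obtain T a where a: "a \<in> \<Sigma>" and T: "crossing P Q i j T" "T \<noteq> prod.swap ` S"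
      and step: "shuffle_step f g a T = prod.swap ` S"
      using predecessor[of "prod.swap ` S"] by blast
    have "crossing Q P j i (prod.swap ` T)"
      using T(1) unfolding crossing_def by force
    moreover have "prod.swap ` T \<noteq> S"
      using T(2) by (auto simp: image_image)
    moreover have "shuffle_step g f a (prod.swap ` T) = S"
      by (simp add: swap_step step swap_swap)
    ultimately show ?thesis using a by blast
  qed
  have swap_pre: "foldr (shuffle_pre g f) w (G \<times> F) = prod.swap ` foldr (shuffle_pre f g) w (F \<times> G)" for w
  proof (induction w)
    case (Cons a w)
    have "shuffle_pre g f a (prod.swap ` R) = prod.swap ` shuffle_pre f g a R" for R
      by (force simp: shuffle_pre_def)
    with Cons show ?case by simp
  qed auto
  show "\<exists>w\<in>lists \<Sigma>. (Q \<times> P) \<inter> foldr (shuffle_pre g f) w (G \<times> F) = {x}"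
    if x: "x \<in> Q \<times> P" for x
  proof -
    have "prod.swap x \<in> P \<times> Q" using x by auto
    from separating[OF this] obtain w where w: "w \<in> lists \<Sigma>"
      and eq: "(P \<times> Q) \<inter> foldr (shuffle_pre f g) w (F \<times> G) = {prod.swap x}" by blast
    have "(Q \<times> P) \<inter> foldr (shuffle_pre g f) w (G \<times> F) =
        prod.swap ` ((P \<times> Q) \<inter> foldr (shuffle_pre f g) w (F \<times> G))"
      unfolding swap_pre by auto
    also have "\<dots> = {x}" by (simp add: eq)
    finally show ?thesis using w by blast
  qed
qed (use fin\<Sigma> finP finQ i j f g F G in auto)

lemma letter_to:
  assumes p: "p \<in> P" and q: "q \<in> Q" and ne: "(p, q) \<noteq> (i, j)"
  shows "\<exists>a\<in>\<Sigma>. f i a = p \<and> g j a = q \<and> (p \<noteq> i \<longrightarrow> q \<noteq> j \<longrightarrow> f p a = i \<and> g q a = j)"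
proof -
  let ?S = "{(i, j), (p, q)}"
  obtain T a r s where a: "a \<in> \<Sigma>" and T: "T \<noteq> ?S" "(i, s) \<in> T" "(r, j) \<in> T"
    and L: "\<And>x y. (x, y) \<in> T \<Longrightarrow> (f x a, y) \<in> ?S"
    and R: "\<And>x y. (x, y) \<in> T \<Longrightarrow> (x, g y a) \<in> ?S"
    and C: "\<And>x y. (x, y) \<in> ?S \<Longrightarrow> (\<exists>t. (t, y) \<in> T \<and> f t a = x) \<or> (\<exists>t. (x, t) \<in> T \<and> g t a = y)"
    by (rule predecessor_elim[of ?S j i]) (use p q i j ne in auto)
  \<comment> \<open>As \<open>T\<close> differs from \<open>?S\<close>, a predecessor inside
    \<open>?S\<close> that contains \<open>(i, j)\<close> can only be
    \<open>{(i, j)}\<close>.\<close>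
  have pq: "(p, q) \<notin> T" if "(i, j) \<in> T" "T \<subseteq> ?S"
    using that T(1) by blast
  consider "p \<noteq> i" "q \<noteq> j" | "p \<noteq> i" "q = j" | "p = i" "q \<noteq> j" using ne by auto
  then show ?thesis
  proof cases
    case 1
    have s: "s = j \<or> s = q" "g s a = j" and r: "r = i \<or> r = p" "f r a = i"
      using L[OF T(2)] R[OF T(2)] L[OF T(3)] R[OF T(3)] 1 by auto
    \<comment> \<open>For \<open>s = j\<close> the letter fixes both \<open>i\<close> and
      \<open>j\<close>, so \<open>T\<close> shrinks to \<open>{(i, j)}\<close>, from which
      \<open>(p, q)\<close> is not reached.\<close>
    have "s \<noteq> j"
    proof
      assume "s = j"
      then have fi: "f i a = i" and gj: "g j a = j" and ij: "(i, j) \<in> T"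
        using s L[OF T(2)] T(2) 1 by auto
      have "T \<subseteq> ?S"
      proof (rule subrelI)
        fix x y assume xy: "(x, y) \<in> T"
        show "(x, y) \<in> ?S" using L[OF xy] R[OF xy] fi gj 1 by auto
      qed
      with pq ij have "T = {(i, j)}" by blast
      with C[of p q] 1 show False by auto
    qed
    then have "s = q" "f i a = p" using s L[OF T(2)] 1 by auto
    moreover from this r 1 have "r = p" by auto
    ultimately show ?thesis using s r R[OF T(3)] 1 a by auto
  next
    case 2
    have "s = j" using L[OF T(2)] 2 by auto
    have "T \<subseteq> ?S" using L R 2 by fastforce
    with pq \<open>s = j\<close> T(2) have "T = {(i, j)}" by blast
    with C[of p q] T(2) R[of i j] 2 show ?thesis using a by auto
  next
    case 3
    have "r = i" using R[OF T(3)] 3 by auto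
    have "T \<subseteq> ?S" using L R 3 by fastforce
    with pq \<open>r = i\<close> T(3) have "T = {(i, j)}" by blast
    with C[of p q] T(3) L[of i j] 3 show ?thesis using a by auto
  qed
qed

text \<open>If a backward step from \<open>R\<close> gives only \<open>(p, q)\<close>, every point
  of \<open>R\<close> pulls back within its column along the bijection of rows, so \<open>R\<close>
  is a single point of column \<open>q\<close>. Running this along separating words puts the final
  pairs into every column at once.\<close>

lemma no_row_permutations:
  assumes perm: "\<And>a. a \<in> \<Sigma> \<Longrightarrow> inj_on (\<lambda>x. f x a) P" and Q: "card Q \<ge> 2"
  shows False
proof -
  have onto: "\<exists>r'\<in>P. f r' a = r" if "r \<in> P" "a \<in> \<Sigma>" for r a
  proof -
    have "(\<lambda>x. f x a) ` P = P"
      by (rule endo_inj_surj) (use finP f that(2) perm in auto)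
    with that(1) have "r \<in> (\<lambda>x. f x a) ` P" by simp
    then show ?thesis by blast
  qed
  have final: "F \<times> G \<subseteq> P \<times> {q} \<and> F \<times> G \<noteq> {}"
    if "w \<in> lists \<Sigma>" "p \<in> P" "q \<in> Q" "(P \<times> Q) \<inter> foldr (shuffle_pre f g) w (F \<times> G) = {(p, q)}"
    for w p q
    using that
  proof (induction w arbitrary: p)
    case Nil
    then show ?case using F G by auto
  next
    case (Cons a w)
    let ?R = "(P \<times> Q) \<inter> foldr (shuffle_pre f g) w (F \<times> G)"
    have a: "a \<in> \<Sigma>" using Cons.hyps by simp
    have "?R \<subseteq> {(f p a, q)}"
    proof (rule subrelI)
      fix r s assume rs: "(r, s) \<in> ?R"
      then obtain r' where r': "r' \<in> P" "f r' a = r" using onto a by blast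
      then have "(r', s) \<in> (P \<times> Q) \<inter> foldr (shuffle_pre f g) (a # w) (F \<times> G)"
        using rs by (simp add: shuffle_pre_def)
      then show "(r, s) \<in> {(f p a, q)}" using Cons.prems(3) r' by auto
    qed
    moreover have "?R \<noteq> {}"
    proof -
      have "(p, q) \<in> foldr (shuffle_pre f g) (a # w) (F \<times> G)" using Cons.prems(3) by blast
      moreover have "f p a \<in> P" "g q a \<in> Q" using Cons.prems(1,2) f g a by blast+
      ultimately show ?thesis using Cons.prems(1,2) unfolding shuffle_pre_def by auto
    qed
    ultimately have "?R = {(f p a, q)}" by blast
    moreover have "f p a \<in> P" using f a Cons.prems(1) by blast
    ultimately show ?case using Cons.IH[of "f p a"] Cons.prems(2) by blast
  qed
  have col: "F \<times> G \<subseteq> P \<times> {q} \<and> F \<times> G \<noteq> {}" if "q \<in> Q" for q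
    using separating[of "(i, q)"] final i that by blast
  obtain q where q: "q \<in> Q" "q \<noteq> j"
  proof -
    have "\<not> Q \<subseteq> {j}" using Q card_mono[of "{j}" Q] by auto
    then show thesis using that by blast
  qed
  show False using col[OF q(1)] col[OF j] q(2) by blast
qed

end

text \<open>Otherwise all of \<open>Z\<close> would be an image of the smaller set
  \<open>Z - D\<close>.\<close>

lemma not_covered_by_image_of_Diff:
  assumes Z: "finite Z" "D \<subseteq> Z" "D \<noteq> {}" "D \<subseteq> h ` (Z - D)"
  shows "\<exists>z\<in>Z - D. z \<notin> h ` (Z - D)"
proof (rule ccontr)
  assume "\<not> ?thesis"
  then have "Z \<subseteq> h ` (Z - D)" using Z by blast
  then have "card Z \<le> card (h ` (Z - D))" using Z(1) by (intro card_mono) auto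
  also have "\<dots> \<le> card (Z - D)" using Z(1) by (intro card_image_le) auto
  also have "\<dots> < card Z" using Z by (intro psubset_card_mono) auto
  finally show False by simp
qed

section \<open>Fewer letters than grid points: the contradictions\<close>

locale small_shuffle_grid = shuffle_grid +
  assumes small: "card \<Sigma> < card P * card Q"
begin

lemma small_mirror: "small_shuffle_grid \<Sigma> Q P j i g f G F"
  using mirror small by (simp add: small_shuffle_grid_def small_shuffle_grid_axioms_def mult.commute)

text \<open>\<open>letter_to\<close> injects the grid points other than \<open>(i, j)\<close> into
  the letters. With so few letters the injection is onto, so each letter is determined by where it
  sends \<open>i\<close> and \<open>j\<close>, and has the properties found there.\<close>

lemma exact_letters:
  shows moves_start: "a \<in> \<Sigma> \<Longrightarrow> (f i a, g j a) \<noteq> (i, j)"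
    and swaps: "a \<in> \<Sigma> \<Longrightarrow> f i a \<noteq> i \<Longrightarrow> g j a \<noteq> j \<Longrightarrow> f (f i a) a = i \<and> g (g j a) a = j"
    and letter_eqI: "a \<in> \<Sigma> \<Longrightarrow> b \<in> \<Sigma> \<Longrightarrow> f i a = f i b \<Longrightarrow> g j a = g j b \<Longrightarrow> a = b"
proof -
  let ?D = "P \<times> Q - {(i, j)}"
  have "\<forall>z\<in>?D. \<exists>a\<in>\<Sigma>. f i a = fst z \<and> g j a = snd z \<and>
      (fst z \<noteq> i \<longrightarrow> snd z \<noteq> j \<longrightarrow> f (fst z) a = i \<and> g (snd z) a = j)"
  proof
    fix z assume z: "z \<in> ?D"
    show "\<exists>a\<in>\<Sigma>. f i a = fst z \<and> g j a = snd z \<and>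
        (fst z \<noteq> i \<longrightarrow> snd z \<noteq> j \<longrightarrow> f (fst z) a = i \<and> g (snd z) a = j)"
      by (rule letter_to) (use z in auto)
  qed
  then obtain b where "\<forall>z\<in>?D. b z \<in> \<Sigma> \<and> f i (b z) = fst z \<and> g j (b z) = snd z \<and>
      (fst z \<noteq> i \<longrightarrow> snd z \<noteq> j \<longrightarrow> f (fst z) (b z) = i \<and> g (snd z) (b z) = j)"
    using bchoice[of ?D "\<lambda>z a. a \<in> \<Sigma> \<and> f i a = fst z \<and> g j a = snd z \<and>
      (fst z \<noteq> i \<longrightarrow> snd z \<noteq> j \<longrightarrow> f (fst z) a = i \<and> g (snd z) a = j)"] by blast
  then have b: "b (p, q) \<in> \<Sigma>" "f i (b (p, q)) = p" "g j (b (p, q)) = q"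
      "p \<noteq> i \<Longrightarrow> q \<noteq> j \<Longrightarrow> f p (b (p, q)) = i \<and> g q (b (p, q)) = j"
    if "(p, q) \<in> ?D" for p q
    using that by (metis fst_conv snd_conv)+
  have "inj_on b ?D"
  proof (rule inj_onI)
    fix z z' assume "z \<in> ?D" "z' \<in> ?D" and eq: "b z = b z'"
    moreover obtain p q p' q' where "z = (p, q)" "z' = (p', q')" by fastforce
    ultimately show "z = z'" using b(2,3)[of p q] b(2,3)[of p' q'] by metis
  qed
  then have "card (b ` ?D) = card ?D" by (rule card_image)
  also have "\<dots> = card P * card Q - 1"
    using finP finQ i j by (simp add: card_cartesian_product)
  finally have "card \<Sigma> \<le> card (b ` ?D)" using small by simp
  then have onto: "b ` ?D = \<Sigma>" by (intro card_seteq fin\<Sigma>) (use b in auto)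
  have eq: "a = b (f i a, g j a) \<and> (f i a, g j a) \<in> ?D" if a: "a \<in> \<Sigma>" for a
  proof -
    from a onto obtain p q where pq: "(p, q) \<in> ?D" "a = b (p, q)" by force
    then show ?thesis using b(2,3)[OF pq(1)] by simp
  qed
  show "(f i a, g j a) \<noteq> (i, j)" if "a \<in> \<Sigma>"
    using eq[OF that] by blast
  show "f (f i a) a = i \<and> g (g j a) a = j" if "a \<in> \<Sigma>" "f i a \<noteq> i" "g j a \<noteq> j"
    using b(4)[of "f i a" "g j a"] eq[OF that(1)] that(2,3) by simp
  show "a = c" if "a \<in> \<Sigma>" "c \<in> \<Sigma>" "f i a = f i c" "g j a = g j c" for c
    using eq[OF that(1)] eq[OF that(2)] that(3,4) by metis
qed

text \<open>The letter reaching \<open>?S\<close> must swap \<open>i\<close> with \<open>p\<close>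
  and \<open>j\<close> with \<open>q\<close>. Sorting the points of \<open>X \<times> Y\<close> by
  whether their states are sent back to \<open>i\<close> or \<open>j\<close> then leaves one of them
  without an origin.\<close>

lemma not_both_large:
  assumes P3: "card P \<ge> 3" and Q3: "card Q \<ge> 3"
  shows False
proof -
  define X where "X = P - {i}"
  define Y where "Y = Q - {j}"
  have X: "finite X" "card X \<ge> 2" "i \<notin> X" and Y: "finite Y" "card Y \<ge> 2" "j \<notin> Y"
    using P3 Q3 finP finQ i j by (simp_all add: X_def Y_def)
  obtain x0 y0 where x0: "x0 \<in> X" and y0: "y0 \<in> Y"
    using X(2) Y(2) by (metis all_not_in_conv card.empty not_numeral_le_zero)
  have P: "P = insert i X" and Q: "Q = insert j Y" using i j by (auto simp: X_def Y_def)
  let ?S = "insert (i, j) (X \<times> Y)"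
  obtain T a r s where a: "a \<in> \<Sigma>" and T: "T \<subseteq> P \<times> Q" "(i, s) \<in> T" "(r, j) \<in> T"
    and L: "\<And>x y. (x, y) \<in> T \<Longrightarrow> (f x a, y) \<in> ?S"
    and R: "\<And>x y. (x, y) \<in> T \<Longrightarrow> (x, g y a) \<in> ?S"
    and C: "\<And>x y. (x, y) \<in> ?S \<Longrightarrow> (\<exists>t. (t, y) \<in> T \<and> f t a = x) \<or> (\<exists>t. (x, t) \<in> T \<and> g t a = y)"
    by (rule predecessor_elim[of ?S j i]) (use P Q x0 y0 X(3) in auto)
  define p where "p = f i a"
  define q where "q = g j a"
  have p: "p \<noteq> i"
  proof
    assume "p = i"
    then have "s = j" using L[OF T(2)] X(3) by (auto simp: p_def)
    then have "q = j" using R[OF T(2)] X(3) by (auto simp: q_def)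
    with \<open>p = i\<close> moves_start[OF a] show False by (simp add: p_def q_def)
  qed
  have q: "q \<noteq> j"
  proof
    assume "q = j"
    then have "r = i" using R[OF T(3)] Y(3) by (auto simp: q_def)
    then have "p = i" using L[OF T(3)] Y(3) by (auto simp: p_def)
    with p show False ..
  qed
  have fp: "f p a = i" and gq: "g q a = j" using swaps[OF a] p q by (auto simp: p_def q_def)
  have pX: "p \<in> X" and qY: "q \<in> Y" using f[OF i a] g[OF j a] p q by (auto simp: X_def Y_def p_def q_def)
  define A where "A = {x \<in> X. f x a = i}"
  define B where "B = {y \<in> Y. g y a = j}"
  have pA: "p \<in> A" and qB: "q \<in> B" using fp gq pX qY by (auto simp: A_def B_def)
  \<comment> \<open>The four alternatives are an origin in row \<open>i\<close>, in another row, in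
    column \<open>j\<close>, or in another column. The other successor of that origin must lie in
    \<open>?S\<close> too, which decides membership in \<open>B\<close> or \<open>A\<close>.\<close>
  have cover: "(x = p \<and> y \<in> B) \<or> (y \<notin> B \<and> x \<in> (\<lambda>t. f t a) ` (X - A)) \<or>
      (y = q \<and> x \<in> A) \<or> (x \<notin> A \<and> y \<in> (\<lambda>t. g t a) ` (Y - B))"
    if x: "x \<in> X" and y: "y \<in> Y" for x y
  proof -
    have xy: "(x, y) \<in> ?S" "x \<noteq> i" "y \<noteq> j" using x y X(3) Y(3) by auto
    from C[OF xy(1)] consider t where "(t, y) \<in> T" "f t a = x" | t where "(x, t) \<in> T" "g t a = y" by blast
    then show ?thesis
    proof cases
      case 1
      note LR = L[OF 1(1)] R[OF 1(1)]
      have "t \<in> P" using 1(1) T(1) by auto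
      show ?thesis
      proof (cases "t = i")
        case True
        then have "g y a = j" using LR X(3) by auto
        then show ?thesis using True 1(2) y by (simp add: p_def B_def)
      next
        case False
        then have "g y a \<noteq> j" using LR Y(3) by auto
        moreover have "t \<in> X - A" using False \<open>t \<in> P\<close> 1(2) xy(2) by (auto simp: A_def P)
        ultimately show ?thesis using 1(2) by (auto simp: B_def)
      qed
    next
      case 2
      note LR = L[OF 2(1)] R[OF 2(1)]
      have "t \<in> Q" using 2(1) T(1) by auto
      show ?thesis
      proof (cases "t = j")
        case True
        then have "f x a = i" using LR Y(3) by auto
        then show ?thesis using True 2(2) x by (simp add: q_def A_def)
      next
        case False
        then have "f x a \<noteq> i" using LR X(3) by auto
        moreover have "t \<in> Y - B" using False \<open>t \<in> Q\<close> 2(2) xy(3) by (auto simp: B_def Q)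
        ultimately show ?thesis using 2(2) by (auto simp: A_def)
      qed
    qed
  qed
  \<comment> \<open>Here the sizes matter: if all of \<open>X\<close> went to \<open>i\<close>, a
    point off row \<open>p\<close> and column \<open>q\<close> would be uncovered.\<close>
  have "Y - B \<noteq> {}"
  proof (cases "X - A = {}")
    case True
    obtain x where x: "x \<in> X" "x \<noteq> p"
      using X(2) card_mono[of "{p}" X] by fastforce
    obtain y where y: "y \<in> Y" "y \<noteq> q"
      using Y(2) card_mono[of "{q}" Y] by fastforce
    show ?thesis using cover[OF x(1) y(1)] x y True by blast
  next
    case False
    then obtain x where "x \<in> X" "x \<notin> A" by blast
    then show ?thesis using cover[of x q] pA qB qY by blast
  qed
  then obtain y where y: "y \<in> Y" "y \<notin> B" by blast
  have AX: "A \<subseteq> X" "B \<subseteq> Y" by (auto simp: A_def B_def)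
  \<comment> \<open>In a column outside \<open>B\<close>, only the second alternative of
    \<open>cover\<close> is left for points with \<open>x\<close> in \<open>A\<close>.\<close>
  have A_im: "A \<subseteq> (\<lambda>t. f t a) ` (X - A)"
    using cover[OF _ y(1)] y qB by (auto simp: A_def)
  then obtain x' where x': "x' \<in> X - A"
    using pA by blast
  have B_im: "B \<subseteq> (\<lambda>t. g t a) ` (Y - B)"
    using cover[of x'] x' pA by (auto simp: B_def)
  obtain x where x: "x \<in> X - A" "x \<notin> (\<lambda>t. f t a) ` (X - A)"
    using not_covered_by_image_of_Diff[OF X(1) AX(1) _ A_im] pA by blast
  obtain y where y: "y \<in> Y - B" "y \<notin> (\<lambda>t. g t a) ` (Y - B)"
    using not_covered_by_image_of_Diff[OF Y(1) AX(2) _ B_im] qB by blast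
  show False using cover[of x y] x y by blast
qed

text \<open>All letters turn out to permute \<open>P\<close>. One sending \<open>i\<close> to
  \<open>p\<close> is \<open>b\<close> or falls under \<open>swaps\<close>; one fixing
  \<open>i\<close> is shown to fix \<open>p\<close>.\<close>

lemma two_rows_permutations:
  assumes P: "P = {i, p}" "p \<noteq> i" and Q: "card Q \<ge> 2"
    and b: "b \<in> \<Sigma>" "f i b = p" "g j b = j" "f p b = i"
  shows False
proof (rule no_row_permutations[OF _ Q])
  have sw: "f p c = i" if "c \<in> \<Sigma>" "f i c = p" for c
    using swaps[OF that(1)] letter_eqI[OF that(1) b(1)] that b P(2) by metis
  show "inj_on (\<lambda>x. f x a) P" if a: "a \<in> \<Sigma>" for a
  proof (cases "f i a = p")
    case True
    then show ?thesis using sw[OF a] P by (auto simp: inj_on_def)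
  next
    case False
    then have fi: "f i a = i" using f[OF i a] P by auto
    define q where "q = g j a"
    have q: "q \<noteq> j" "q \<in> Q" using moves_start[OF a] fi g[OF j a] by (auto simp: q_def)
    \<comment> \<open>Column \<open>j\<close> of this set is just \<open>(p, j)\<close>. So a letter
      that reaches it and fixes \<open>i\<close> must fix \<open>p\<close>, and it turns out to be
      \<open>a\<close>.\<close>
    let ?S = "{(i, q), (p, j), (p, q)}"
    obtain T c r where c: "c \<in> \<Sigma>" and T: "T \<subseteq> P \<times> Q" "(r, j) \<in> T"
      and L: "\<And>x y. (x, y) \<in> T \<Longrightarrow> (f x c, y) \<in> ?S"
      and R: "\<And>x y. (x, y) \<in> T \<Longrightarrow> (x, g y c) \<in> ?S"
      and C: "\<And>x y. (x, y) \<in> ?S \<Longrightarrow> (\<exists>t. (t, y) \<in> T \<and> f t c = x) \<or> (\<exists>t. (x, t) \<in> T \<and> g t c = y)"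
      by (rule predecessor_elim[of ?S q p]) (use P q j in auto)
    have r: "r = i \<or> r = p" using T P by auto
    have "f i c \<noteq> p"
    proof
      assume fc: "f i c = p"
      have fpc: "f p c = i" by (rule sw[OF c fc])
      have "r = i" using r L[OF T(2)] fpc q P by auto
      then have gj: "g j c = q" using R[OF T(2)] P by auto
      then have gq: "g q c = j" using swaps[OF c] fc P q by auto
      \<comment> \<open>With both pairs of states swapped, \<open>(p, q)\<close> has no possible
        origin.\<close>
      consider t where "(t, q) \<in> T" "f t c = p" | t where "(p, t) \<in> T" "g t c = q"
        using C[of p q] by blast
      then show False
      proof cases
        case 1
        then have "t = i" using T(1) P fpc by auto
        then show False using R[OF 1(1)] gq P q by auto
      next
        case 2
        then show False using L[OF 2(1)] fpc gq P q by auto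
      qed
    qed
    then have fic: "f i c = i" using f[OF i c] P by auto
    then have "r = p" using r L[OF T(2)] q P by auto
    then have "f p c = p" "g j c = q"
      using L[OF T(2)] R[OF T(2)] moves_start[OF c] fic P q by auto
    moreover from this have "c = a" using letter_eqI[OF c a] fic fi by (simp add: q_def)
    ultimately show ?thesis using fi P by (auto simp: inj_on_def)
  qed
qed

text \<open>For \<open>Q = {j, q}\<close> the letter \<open>c\<close> is the transposition required of \<open>b\<close> in the previous lemma,
  with the roles of \<open>P\<close> and \<open>Q\<close> exchanged.\<close>

lemma two_rows_collapse:
  assumes P: "P = {i, p}" "p \<noteq> i" and q: "q \<in> Q" "q \<noteq> j"
    and b: "b \<in> \<Sigma>" "f i b = p" "g j b = j" "f p b \<noteq> i"
  shows "\<exists>c\<in>\<Sigma>. f i c = i \<and> g j c = q \<and> f p c = i \<and> g q c = j"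
proof -
  let ?S = "{(i, j), (i, q), (p, j)}"
  obtain T c r s where c: "c \<in> \<Sigma>" and T: "T \<subseteq> P \<times> Q" "(i, s) \<in> T" "(r, j) \<in> T"
    and L: "\<And>x y. (x, y) \<in> T \<Longrightarrow> (f x c, y) \<in> ?S"
    and R: "\<And>x y. (x, y) \<in> T \<Longrightarrow> (x, g y c) \<in> ?S"
    and C: "\<And>x y. (x, y) \<in> ?S \<Longrightarrow> (\<exists>t. (t, y) \<in> T \<and> f t c = x) \<or> (\<exists>t. (x, t) \<in> T \<and> g t c = y)"
    by (rule predecessor_elim[of ?S j i]) (use P q j in auto)
  have r: "r = i \<or> r = p" and fc: "f i c = i \<or> f i c = p" "f p c = i \<or> f p c = p"
    using T P f[OF i c] f[of p c] c by auto
  \<comment> \<open>Otherwise row \<open>i\<close> of \<open>T\<close> is just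
    \<open>(i, j)\<close>, which leaves \<open>(i, q)\<close> uncovered if \<open>c = b\<close> and
    \<open>(i, j)\<close> uncovered if not.\<close>
  have "f i c \<noteq> p"
  proof
    assume fic: "f i c = p"
    have s: "t = j" if "(i, t) \<in> T" for t using L[OF that] fic P by auto
    show False
    proof (cases "g j c = j")
      case True
      then have "c = b" using letter_eqI[OF c b(1)] fic b by simp
      then have "f p c = p" using b fc by auto
      then show False using C[of i q] T(1) P fic s True q by auto
    next
      case False
      then have fpc: "f p c = i" using swaps[OF c] fic P by auto
      have "g j c = q" using s R[OF T(2)] T(2) False P by auto
      have "(p, j) \<notin> T" using R[of p j] \<open>g j c = q\<close> P q by auto
      from C[of i j] consider t where "(t, j) \<in> T" "f t c = i" | t where "(i, t) \<in> T" "g t c = j"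
        by blast
      then show False
      proof cases
        case 1
        then have "t = i \<or> t = p" using T(1) P by auto
        then show False using 1 \<open>(p, j) \<notin> T\<close> fic P by auto
      next
        case 2
        then show False using s[OF 2(1)] False by simp
      qed
    qed
  qed
  with fc have fic: "f i c = i" by blast
  then have gj: "g j c \<noteq> j" using moves_start[OF c] by auto
  have pj: "(p, j) \<notin> T" using R[of p j] gj P by auto
  have "f p c \<noteq> p"
  proof
    assume fpc: "f p c = p"
    then obtain t where t: "(p, t) \<in> T" using C[of p j] T(1) P fic pj by auto
    then have "t = j" using L[OF t] fpc P by auto
    then show False using t pj by simp
  qed
  with fc have fpc: "f p c = i" by blast
  have "(i, j) \<in> T" using r T(3) pj by auto
  then have "g j c = q" using R[of i j] gj P by auto
  moreover obtain t where t: "(p, t) \<in> T" "g t c = j" using C[of p j] T(1) P fic fpc by auto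
  moreover have "t = q" using L[OF t(1)] fpc t(2) gj P by auto
  ultimately show ?thesis using c fic fpc by auto
qed

text \<open>Pigeonhole: each \<open>Z\<close> in \<open>\<Z>\<close> requires a letter sending
  \<open>i\<close> to \<open>p\<close> and \<open>j\<close> into \<open>Y\<close>, and
  \<open>Z\<close> can be read back from that letter. Such letters are told apart by the image of
  \<open>j\<close>, so there are at most \<open>card Y\<close>, one fewer than sets in
  \<open>\<Z>\<close>.\<close>

lemma two_rows_constant:
  assumes P: "P = {i, p}" "p \<noteq> i" and Q3: "card Q \<ge> 3"
    and b: "b \<in> \<Sigma>" "f i b = p" "g j b = j" "f p b \<noteq> i"
  shows False
proof -
  define Y where "Y = Q - {j}"
  have Y: "finite Y" "card Y \<ge> 2" "j \<notin> Y" "Q = insert j Y"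
    using Q3 finQ j by (auto simp: Y_def)
  have fpb: "f p b = p" using f[of p b] P b by auto
  have collapse: "f p c = i" if "c \<in> \<Sigma>" "f i c = i" for c
  proof -
    have "g j c \<in> Q" "g j c \<noteq> j" using that moves_start[OF that(1)] g j by auto
    from two_rows_collapse[OF P this b] obtain d
      where "d \<in> \<Sigma>" "f i d = i" "g j d = g j c" "f p d = i" by blast
    then show ?thesis using letter_eqI[of c d] that by simp
  qed
  define \<Z> where "\<Z> = insert {} ((\<lambda>z. {z}) ` Y)"
  have letter: "\<exists>c. c \<in> \<Sigma> \<and> f i c = p \<and> g j c \<in> Y \<and> (\<lambda>y. g y c) ` Y - {j} = Z" if "Z \<in> \<Z>" for Z
  proof -
    have Z: "Z \<subseteq> Y" "\<And>z z'. z \<in> Z \<Longrightarrow> z' \<in> Z \<Longrightarrow> z = z'" using that by (auto simp: \<Z>_def)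
    have jZ: "j \<notin> Z" using Z Y by auto
    have cZ: "finite Z" "card Z \<le> 1" using that by (auto simp: \<Z>_def)
    obtain y0 where y0: "y0 \<in> Y"
      using Y(2) by (metis all_not_in_conv card.empty not_numeral_le_zero)
    let ?S = "{i} \<times> Y \<union> {p} \<times> insert j Z"
    obtain T c r s where c: "c \<in> \<Sigma>" and T: "T \<subseteq> P \<times> Q" "(i, s) \<in> T" "(r, j) \<in> T"
      and L: "\<And>x y. (x, y) \<in> T \<Longrightarrow> (f x c, y) \<in> ?S"
      and R: "\<And>x y. (x, y) \<in> T \<Longrightarrow> (x, g y c) \<in> ?S"
      and C: "\<And>x y. (x, y) \<in> ?S \<Longrightarrow> (\<exists>t. (t, y) \<in> T \<and> f t c = x) \<or> (\<exists>t. (x, t) \<in> T \<and> g t c = y)"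
      by (rule predecessor_elim[of ?S y0 p]) (use P y0 Z Y i in auto)
    have r: "r = i \<or> r = p" using T(1,3) P by auto
    have "f i c \<noteq> i"
    proof
      assume "f i c = i"
      then have "f r c = i" using collapse[OF c] r by auto
      then show False using L[OF T(3)] Y(3) P by auto
    qed
    then have fic: "f i c = p" using f[OF i c] P by auto
    have gj: "g j c \<noteq> j"
    proof
      assume gj: "g j c = j"
      then have "c = b" using letter_eqI[OF c b(1)] fic b by simp
      then have fpc: "f p c = p" using fpb by simp
      \<comment> \<open>\<open>c\<close> now sends both rows to \<open>p\<close>, so row
        \<open>i\<close> of \<open>?S\<close> must be filled by moves within row \<open>i\<close>,
        and these start in \<open>Z\<close>.\<close>
      have "Y \<subseteq> (\<lambda>y. g y c) ` Z"
      proof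
        fix y assume "y \<in> Y"
        then obtain t where t: "(i, t) \<in> T" "g t c = y"
          using C[of i y] T(1) P fic fpc by auto
        then have "t \<in> Z" using L[OF t(1)] fic gj \<open>y \<in> Y\<close> Y(3) P by auto
        then show "y \<in> (\<lambda>y. g y c) ` Z" using t by auto
      qed
      then have "card Y \<le> card Z" using cZ(1) surj_card_le by blast
      then show False using cZ Y by simp
    qed
    define q where "q = g j c"
    have fpc: "f p c = i" and gq: "g q c = j" using swaps[OF c] fic gj P by (auto simp: q_def)
    have row_i: "t \<in> insert j Z \<and> g t c \<noteq> j \<and> t \<noteq> q" if "(i, t) \<in> T" for t
      using L[OF that] R[OF that] fic P Y(3) gq by auto
    have row_p: "t \<in> Y \<and> g t c \<in> insert j Z" if "(p, t) \<in> T" for t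
      using L[OF that] R[OF that] fpc P by auto
    have cov_i: "(p, y) \<in> T \<or> (\<exists>t. (i, t) \<in> T \<and> g t c = y)" if "y \<in> Y" for y
      using C[of i y] T(1) P fic that by auto
    have cov_p: "(i, z) \<in> T \<or> (\<exists>t. (p, t) \<in> T \<and> g t c = z)" if "z \<in> Z" for z
      using C[of p z] T(1) P fpc that by auto
    \<comment> \<open>\<open>Z\<close> has at most one element, so it suffices that
      \<open>g z c\<close> lies in \<open>Z\<close>, or that \<open>z\<close> is the image of an
      element of \<open>Z\<close>.\<close>
    have fixed: "g z c = z" if z: "z \<in> Z" "(i, z) \<in> T" for z
    proof -
      have "z \<in> Y" using z Z by auto
      from cov_i[OF this] show ?thesis
      proof
        assume "(p, z) \<in> T"
        then show ?thesis using row_p row_i[OF z(2)] Z(2) z(1) by blast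
      next
        assume "\<exists>t. (i, t) \<in> T \<and> g t c = z"
        then obtain t where t: "(i, t) \<in> T" "g t c = z" by blast
        then have "t \<noteq> j" using row_i[OF z(2)] by (auto simp: q_def)
        then show ?thesis using row_i[OF t(1)] Z(2)[of t z] z t by auto
      qed
    qed
    have "(\<lambda>y. g y c) ` Y - {j} \<subseteq> Z"
    proof
      fix v assume "v \<in> (\<lambda>y. g y c) ` Y - {j}"
      then obtain y where y: "y \<in> Y" "v = g y c" "g y c \<noteq> j" by auto
      from cov_i[OF y(1)] show "v \<in> Z"
      proof
        assume "(p, y) \<in> T"
        then show ?thesis using row_p y by blast
      next
        assume "\<exists>t. (i, t) \<in> T \<and> g t c = y"
        then obtain t where t: "(i, t) \<in> T" "g t c = y" by blast
        then have "t \<noteq> j" using y gq by (auto simp: q_def)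
        then have "t \<in> Z" using row_i[OF t(1)] by blast
        then show ?thesis using fixed[OF _ t(1)] t y by simp
      qed
    qed
    moreover have "Z \<subseteq> (\<lambda>y. g y c) ` Y - {j}"
    proof
      fix z assume z: "z \<in> Z"
      from cov_p[OF z] show "z \<in> (\<lambda>y. g y c) ` Y - {j}"
      proof
        assume "(i, z) \<in> T"
        then show ?thesis using fixed[OF z] z Z(1) jZ by (metis DiffI image_eqI singletonD subsetD)
      next
        assume "\<exists>t. (p, t) \<in> T \<and> g t c = z"
        then show ?thesis using row_p z jZ by blast
      qed
    qed
    moreover have "g j c \<in> Y" using gj g[OF j c] by (simp add: Y_def)
    ultimately show ?thesis using c fic by blast
  qed
  then obtain h where h: "\<And>Z. Z \<in> \<Z> \<Longrightarrow> h Z \<in> \<Sigma> \<and> f i (h Z) = p \<and> g j (h Z) \<in> Y \<and>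
      (\<lambda>y. g y (h Z)) ` Y - {j} = Z"
    by metis
  have "inj_on (\<lambda>Z. g j (h Z)) \<Z>"
  proof (rule inj_onI)
    fix Z Z' assume Z: "Z \<in> \<Z>" "Z' \<in> \<Z>" "g j (h Z) = g j (h Z')"
    then have "h Z = h Z'" using h[OF Z(1)] h[OF Z(2)] by (intro letter_eqI) simp_all
    moreover have "(\<lambda>y. g y (h Z)) ` Y - {j} = Z" "(\<lambda>y. g y (h Z')) ` Y - {j} = Z'"
      using h[OF Z(1)] h[OF Z(2)] by blast+
    ultimately show "Z = Z'" by metis
  qed
  then have "card \<Z> \<le> card Y"
    by (rule card_inj_on_le) (use h Y in auto)
  moreover have "card \<Z> = Suc (card Y)"
  proof -
    have "{} \<notin> (\<lambda>z. {z}) ` Y" by auto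
    then have "card \<Z> = Suc (card ((\<lambda>z. {z}) ` Y))" using Y(1) by (simp add: \<Z>_def)
    also have "card ((\<lambda>z. {z}) ` Y) = card Y" by (rule card_image) auto
    finally show ?thesis .
  qed
  ultimately show False by simp
qed

lemma not_two_rows:
  assumes P2: "card P = 2" and Q2: "card Q \<ge> 2"
  shows False
proof -
  interpret mirror: small_shuffle_grid \<Sigma> Q P j i g f G F by (rule small_mirror)
  obtain p where P: "P = {i, p}" "p \<noteq> i"
    using P2 i by (auto simp: card_2_iff)
  obtain b where b: "b \<in> \<Sigma>" "f i b = p" "g j b = j"
    using letter_to[of p j] P j by auto
  show False
  proof (cases "f p b = i")
    case True
    then show False using two_rows_permutations[OF P Q2 b] by blast
  next
    case False
    show False
    proof (cases "card Q = 2")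
      case True
      then obtain q where Q: "Q = {j, q}" "q \<noteq> j"
        using j by (auto simp: card_2_iff)
      then obtain c where "c \<in> \<Sigma>" "f i c = i" "g j c = q" "g q c = j"
        using two_rows_collapse[OF P _ _ b False, of q] by blast
      then show False using mirror.two_rows_permutations[OF Q] P2 by simp
    next
      case False': False
      then show False using two_rows_constant[OF P _ b False] Q2 by simp
    qed
  qed
qed

end

lemma (in shuffle_grid) card_alphabet_ge:
  assumes P2: "card P \<ge> 2" and Q2: "card Q \<ge> 2"
  shows "card \<Sigma> \<ge> card P * card Q"
proof (rule ccontr)
  assume "\<not> ?thesis"
  then interpret small_shuffle_grid by unfold_locales simp
  interpret mirror: small_shuffle_grid \<Sigma> Q P j i g f G F by (rule small_mirror)
  show False
    using not_both_large not_two_rows[OF _ Q2] mirror.not_two_rows[OF _ P2] P2 Q2 by linarith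
qed

section \<open>From automata attaining the bound to grids\<close>

lemma crossing_full_minus_point:
  assumes P: "card P \<ge> 2" "i \<in> P" and Q: "card Q \<ge> 2" "j \<in> Q"
  shows "crossing P Q i j (P \<times> Q - {x})"
proof -
  have "\<not> P \<subseteq> {fst x}" "\<not> Q \<subseteq> {snd x}"
    using P Q card_mono[of "{fst x}" P] card_mono[of "{snd x}" Q] by auto
  then obtain p q where "p \<in> P" "p \<noteq> fst x" "q \<in> Q" "q \<noteq> snd x" by blast
  then have "(i, q) \<in> P \<times> Q - {x}" "(p, j) \<in> P \<times> Q - {x}" using P Q by auto
  then show ?thesis unfolding crossing_def by blast
qed

text \<open>The shuffle automaton is minimal, which gives predecessors at once. For
  \<open>separating\<close>, a word distinguishing the full grid from the grid without
  \<open>x\<close> has a backward image meeting the former but not the latter.\<close>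

lemma shuffle_grid_if_maximal:
  assumes \<Sigma>: "finite \<Sigma>" and A: "complete_dfa \<Sigma> A" and B: "complete_dfa \<Sigma> B"
    and card: "card (states A) \<ge> 2" "card (states B) \<ge> 2"
    and max: "state_complexity \<Sigma> (lang_shuffle (dfa_lang \<Sigma> A) (dfa_lang \<Sigma> B)) \<ge>
      card (states (shuffle_dfa A B))"
  shows "shuffle_grid \<Sigma> (states A) (states B) (init A) (init B) (trans A) (trans B) (final A) (final B)"
proof
  let ?N = "shuffle_dfa A B" and ?P = "states A" and ?Q = "states B"
  have N: "complete_dfa \<Sigma> ?N" by (rule complete_shuffle_dfa[OF A B])
  have min: "state_complexity \<Sigma> (dfa_lang \<Sigma> ?N) \<ge> card (states ?N)"
    using max by (simp add: dfa_lang_shuffle_dfa[OF A B])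
  have states: "S \<in> states ?N \<longleftrightarrow> crossing ?P ?Q (init A) (init B) S" for S
    by (simp add: shuffle_dfa_def)
  show "\<exists>T. \<exists>a\<in>\<Sigma>. crossing ?P ?Q (init A) (init B) T \<and> T \<noteq> S \<and>
      shuffle_step (trans A) (trans B) a T = S"
    if "crossing ?P ?Q (init A) (init B) S" "S \<noteq> {(init A, init B)}" for S
    using minimal_dfa_predecessor[OF N min, of S] that by (auto simp: shuffle_dfa_def)
  show "\<exists>w\<in>lists \<Sigma>. (?P \<times> ?Q) \<inter> foldr (shuffle_pre (trans A) (trans B)) w (final A \<times> final B) = {x}"
    if x: "x \<in> ?P \<times> ?Q" for x
  proof -
    have "init A \<in> ?P" "init B \<in> ?Q" using A B by (auto simp: complete_dfa_def)
    then have S: "?P \<times> ?Q - {x} \<in> states ?N" "?P \<times> ?Q \<in> states ?N"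
      using crossing_full_minus_point[OF card(1) _ card(2)] by (auto simp: states crossing_def)
    moreover have "?P \<times> ?Q - {x} \<noteq> ?P \<times> ?Q" using x by blast
    ultimately obtain w where w: "w \<in> lists \<Sigma>" and
      "(foldl (trans ?N) (?P \<times> ?Q - {x}) w \<in> final ?N) \<noteq> (foldl (trans ?N) (?P \<times> ?Q) w \<in> final ?N)"
      using minimal_dfa_distinguishable[OF N min S] by blast
    then have "(?P \<times> ?Q) \<inter> foldr (shuffle_pre (trans A) (trans B)) w (final A \<times> final B) = {x}"
      using foldl_shuffle_dfa_final[OF A B S(1) w] foldl_shuffle_dfa_final[OF A B S(2) w] by blast
    with w show ?thesis by blast
  qed
qed (use \<Sigma> A B in \<open>auto simp: complete_dfa_def\<close>)

theorem mainTheorem4: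
  fixes \<Sigma> :: "'a set" and K L :: "'a list set" and m n :: nat
  assumes "m \<ge> 2" and "n \<ge> 2"
    and "finite \<Sigma>"
    and "regular \<Sigma> K" and "regular \<Sigma> L"
    and "state_complexity \<Sigma> K = m" and "state_complexity \<Sigma> L = n"
    and "state_complexity \<Sigma> (lang_shuffle K L) =
           2 ^ (m * n - 1) + 2 ^ ((m - 1) * (n - 1)) * (2 ^ (m - 1) - 1) * (2 ^ (n - 1) - 1)"
  shows "card \<Sigma> \<ge> m * n"
proof -
  obtain A :: "(nat, 'a) dfa" where A: "complete_dfa \<Sigma> A" "dfa_lang \<Sigma> A = K" "card (states A) = m"
    using state_complexity_attained[OF assms(4)] assms(6) by metis
  obtain B :: "(nat, 'a) dfa" where B: "complete_dfa \<Sigma> B" "dfa_lang \<Sigma> B = L" "card (states B) = n"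
    using state_complexity_attained[OF assms(5)] assms(7) by metis
  \<comment> \<open>The assumed complexity bounds the number of states from above, so the shuffle
    automaton is minimal.\<close>
  have "card (states (shuffle_dfa A B)) \<le>
      2 ^ (m * n - 1) + 2 ^ ((m - 1) * (n - 1)) * (2 ^ (m - 1) - 1) * (2 ^ (n - 1) - 1)"
    using card_crossing_le[of "states A" "init A" "states B" "init B"] A B
    by (simp add: shuffle_dfa_def complete_dfa_def)
  then have max: "card (states (shuffle_dfa A B)) \<le>
      state_complexity \<Sigma> (lang_shuffle (dfa_lang \<Sigma> A) (dfa_lang \<Sigma> B))"
    unfolding A(2) B(2) assms(8) .
  have card: "card (states A) \<ge> 2" "card (states B) \<ge> 2" using A(3) B(3) assms(1,2) by simp_all
  have "card (states A) * card (states B) \<le> card \<Sigma>"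
    by (rule shuffle_grid.card_alphabet_ge
        [OF shuffle_grid_if_maximal[OF assms(3) A(1) B(1) card max] card])
  then show ?thesis by (simp only: A(3) B(3))
qed

end
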